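(* Let $K$ be a graph. For $1$-cycles $C_1,\ldots,C_q$ in $H_1(K)$ denote $$B=B(C_1,\ldots,C_q):=\{C_i\times C_j\ :\ i,j\in\{1,\ldots,q\}\}.$$ (a) There exists a basis $C_1,\ldots,C_q$ of $H_1(K)$ such that $B(C_1,\ldots,C_q)$ is a basis of $H_2(K^2)$. (b) If $C_1,\ldots,C_q$ is a basis of $H_1(K)$, then $B(C_1,\ldots,C_q)$ is a basis of $H_2(K^2)$. (That is, $H_2(K^2)\cong H_1(K)\otimes H_1(K)$, as vector spaces over $\mathbb{Z}_2$.)
   Context: A graph is a finite simple graph, identified with its set of edges. A $1$-cycle in $K$ is a set of edges (possibly empty) such that every vertex belongs to an even number of edges of the set. $H_1(K)$ is the set of all $1$-cycles in $K$ with the operation of sum, where the sum of sets is the symmetric difference. $K^2=K\times K$ is the set of ordered pairs $(\sigma,\tau)$ of edges of $K$. A cellular $2$-cycle in $K^2$ is a subset $C\subset K^2$ such that for every edge $\sigma$ of $K$ both sets $C_{\sigma,\cdot}=\{\tau:(\sigma,\tau)\in C\}$ and $C_{\cdot,\sigma}=\{\tau:(\tau,\sigma)\in C\}$ are $1$-cycles in $K$. $H_2(K^2)$ is the set of all cellular $2$-cycles in $K^2$ with the operation of sum (symmetric difference). For $1$-cycles $C,D$ in $K$ (sets of edges), $C\times D\subset K^2$ is the Cartesian product of sets. A subset $B$ of $H_1(K)$ (respectively of $H_2(K^2)$) is called a basis of it if every element has a unique representation as a sum of several (possibly zero) distinct elements of $B$. *)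

theory Defs
  imports Main
begin

text \<open>A graph is given by its set of edges; an edge is a two-element set of vertices.\<close>

definition graph :: "'a set set \<Rightarrow> bool" where
  "graph K \<longleftrightarrow> finite K \<and> (\<forall>e\<in>K. card e = 2)"

definition one_cycle :: "'a set set \<Rightarrow> 'a set set \<Rightarrow> bool" where
  "one_cycle K C \<longleftrightarrow> C \<subseteq> K \<and> (\<forall>v\<in>\<Union>K. even (card {e \<in> C. v \<in> e}))"

definition H1 :: "'a set set \<Rightarrow> 'a set set set" where
  "H1 K = {C. one_cycle K C}"

definition two_cycle :: "'a set set \<Rightarrow> ('a set \<times> 'a set) set \<Rightarrow> bool" where
  "two_cycle K C \<longleftrightarrow> C \<subseteq> K \<times> K \<and>
     (\<forall>\<sigma>\<in>K. one_cycle K {\<tau>. (\<sigma>, \<tau>) \<in> C} \<and> one_cycle K {\<tau>. (\<tau>, \<sigma>) \<in> C})"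

definition H2 :: "'a set set \<Rightarrow> ('a set \<times> 'a set) set set" where
  "H2 K = {C. two_cycle K C}"

text \<open>The sum of finitely many distinct sets, i.e. their iterated symmetric difference.
  As usual for \<open>Finite_Set.fold\<close>, the value is the initial one on infinite collections;
  only finite collections are used below.\<close>

definition symdiff_sum :: "'b set set \<Rightarrow> 'b set" where
  "symdiff_sum S = Finite_Set.fold sym_diff {} S"

lemma comp_fun_commute_sym_diff: "comp_fun_commute_on UNIV (sym_diff :: 'b set \<Rightarrow> _)"
  by standard (auto simp: fun_eq_iff)

lemma symdiff_sum_empty [simp]: "symdiff_sum {} = {}"
  by (simp add: symdiff_sum_def)

lemma symdiff_sum_insert [simp]:
  "finite S \<Longrightarrow> A \<notin> S \<Longrightarrow> symdiff_sum (insert A S) = sym_diff A (symdiff_sum S)"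
  by (simp add: symdiff_sum_def comp_fun_commute_on.fold_insert[OF comp_fun_commute_sym_diff])

definition is_basis :: "'b set set \<Rightarrow> 'b set set \<Rightarrow> bool" where
  "is_basis B V \<longleftrightarrow> B \<subseteq> V \<and>
     (\<forall>x\<in>V. \<exists>!S. finite S \<and> S \<subseteq> B \<and> symdiff_sum S = x)"

definition product_cycles ::
    "nat \<Rightarrow> (nat \<Rightarrow> 'a set set) \<Rightarrow> ('a set \<times> 'a set) set set" where
  "product_cycles q C = {C i \<times> C j | i j. i \<in> {1..q} \<and> j \<in> {1..q}}"

end

theory Submission
  imports Defs
begin

text \<open>Fix a basis \<open>B\<close> of \<open>H1 K\<close>. Each row of a two-cycle \<open>Z\<close> is a unique sum of elements of \<open>B\<close>;
  for \<open>Y \<in> B\<close> let \<open>U Y\<close> be the set of edges whose row involves \<open>Y\<close>, so that \<open>Z\<close> is the sum of the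
  \<open>U Y \<times> Y\<close>. The columns of \<open>Z\<close> being cycles, the rows over the edges at any given vertex sum
  to zero, and by uniqueness of coefficients each \<open>U Y\<close> is itself a cycle, hence a sum of elements
  of \<open>B\<close>. Uniqueness of the representation of \<open>Z\<close> follows by applying uniqueness in \<open>H1 K\<close> twice,
  first to the rows and then to the coefficient sets.\<close>

section \<open>Parity counts and sums modulo 2\<close>

lemma even_card_sym_diff:
  assumes "finite A" "finite B"
  shows "even (card (sym_diff A B)) \<longleftrightarrow> (even (card A) \<longleftrightarrow> even (card B))"
proof -
  have "card A = card (A - B) + card (A \<inter> B)" "card B = card (B - A) + card (A \<inter> B)"
    using assms by (metis add.commute card_Diff_subset_Int card_Int_Diff inf_commute)+
  moreover have "card (sym_diff A B) = card (A - B) + card (B - A)"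
    using assms by (intro card_Un_disjoint) auto
  ultimately show ?thesis by auto
qed

text \<open>Double counting modulo 2: both sides give the parity of the number of related pairs.
  This is what exchanges a sum over edges with a sum over basis elements.\<close>

lemma odd_card_swap:
  assumes "finite A" "finite B"
  shows "odd (card {a \<in> A. odd (card {b \<in> B. R a b})}) \<longleftrightarrow>
    odd (card {b \<in> B. odd (card {a \<in> A. R a b})})"
proof -
  have "(\<Sum>a\<in>A. card {b \<in> B. R a b}) = (\<Sum>b\<in>B. card {a \<in> A. R a b})"
    using assms by (rule sum_multicount_gen) simp
  then show ?thesis
    using even_sum_iff[OF assms(1), of "\<lambda>a. card {b \<in> B. R a b}"]
      even_sum_iff[OF assms(2), of "\<lambda>b. card {a \<in> A. R a b}"] by simp
qed

lemma odd_card_Collect_conj_const: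
  "odd (card {x \<in> A. P x \<and> c}) \<longleftrightarrow> odd (card {x \<in> A. P x}) \<and> c"
  by (cases c) auto

text \<open>Replaces the fold by a pointwise parity count, the form in which sums are computed from
  here on.\<close>

lemma mem_symdiff_sum:
  assumes "finite S"
  shows "x \<in> symdiff_sum S \<longleftrightarrow> odd (card {A \<in> S. x \<in> A})"
  using assms
proof (induction S)
  case empty
  then show ?case by simp
next
  case (insert A S)
  have "{A' \<in> insert A S. x \<in> A'} =
      (if x \<in> A then insert A {A' \<in> S. x \<in> A'} else {A' \<in> S. x \<in> A'})"
    by auto
  then show ?case using insert by auto
qed

text \<open>Members common to \<open>S\<close> and \<open>T\<close> are counted twice and cancel.
  This is the linearity over Z_2 of the map from coefficient sets to sums.\<close>

lemma symdiff_sum_sym_diff: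
  assumes "finite S" "finite T"
  shows "symdiff_sum (sym_diff S T) = sym_diff (symdiff_sum S) (symdiff_sum T)"
proof (rule set_eqI)
  fix x
  have "{A \<in> sym_diff S T. x \<in> A} = sym_diff {A \<in> S. x \<in> A} {A \<in> T. x \<in> A}" by auto
  then show "x \<in> symdiff_sum (sym_diff S T) \<longleftrightarrow> x \<in> sym_diff (symdiff_sum S) (symdiff_sum T)"
    using assms even_card_sym_diff[of "{A \<in> S. x \<in> A}" "{A \<in> T. x \<in> A}"]
    by (simp only: mem_symdiff_sum finite_Un finite_Diff Un_iff Diff_iff finite_Collect_conjI simp_thms) auto
qed

section \<open>Bases of spaces over Z_2\<close>

definition sym_diff_closed :: "'b set set \<Rightarrow> bool" where
  "sym_diff_closed V \<longleftrightarrow> {} \<in> V \<and> (\<forall>x\<in>V. \<forall>y\<in>V. sym_diff x y \<in> V)"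

lemma symdiff_sum_mem:
  assumes "sym_diff_closed V" "finite S" "S \<subseteq> V"
  shows "symdiff_sum S \<in> V"
  using assms(2,3) by (induction S) (use assms(1) in \<open>auto simp: sym_diff_closed_def\<close>)

text \<open>Existence and uniqueness of representations are surjectivity and injectivity of
  \<open>symdiff_sum\<close> on coefficient sets; closure of \<open>V\<close> keeps the sums inside
  \<open>V\<close>.\<close>

lemma is_basis_iff_bij_betw:
  assumes "finite B" "sym_diff_closed V"
  shows "is_basis B V \<longleftrightarrow> B \<subseteq> V \<and> bij_betw symdiff_sum (Pow B) V"
proof -
  have "finite S" if "S \<subseteq> B" for S using that assms(1) finite_subset by blast
  moreover have "symdiff_sum S \<in> V" if "B \<subseteq> V" "S \<subseteq> B" for S
    using that assms calculation by (meson subset_trans symdiff_sum_mem)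
  moreover have "(\<forall>x\<in>V. \<exists>!S. S \<subseteq> B \<and> symdiff_sum S = x) \<longleftrightarrow> bij_betw symdiff_sum (Pow B) V"
    if sums: "\<And>S. S \<subseteq> B \<Longrightarrow> symdiff_sum S \<in> V"
  proof
    assume *: "\<forall>x\<in>V. \<exists>!S. S \<subseteq> B \<and> symdiff_sum S = x"
    have "inj_on symdiff_sum (Pow B)"
    proof (rule inj_onI)
      fix S T assume "S \<in> Pow B" "T \<in> Pow B" "symdiff_sum S = symdiff_sum T"
      then show "S = T" using * sums by (metis PowD)
    qed
    moreover have "V \<subseteq> symdiff_sum ` Pow B"
    proof
      fix x assume "x \<in> V"
      then obtain S where "S \<subseteq> B" "symdiff_sum S = x" using * by metis
      then show "x \<in> symdiff_sum ` Pow B" by (intro image_eqI[of _ _ S]) simp_all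
    qed
    ultimately show "bij_betw symdiff_sum (Pow B) V" using sums by (auto simp: bij_betw_def)
  next
    assume *: "bij_betw symdiff_sum (Pow B) V"
    show "\<forall>x\<in>V. \<exists>!S. S \<subseteq> B \<and> symdiff_sum S = x"
    proof
      fix x assume "x \<in> V"
      then obtain S where "S \<subseteq> B" "symdiff_sum S = x"
        using * by (metis PowD bij_betw_imp_surj_on imageE)
      then show "\<exists>!S. S \<subseteq> B \<and> symdiff_sum S = x"
        using * by (metis PowI bij_betw_imp_inj_on inj_onD)
    qed
  qed
  ultimately show ?thesis unfolding is_basis_def by (smt (verit, best))
qed

text \<open>A spanning set of least cardinality is a basis, since a nontrivial relation would allow
  one of its elements to be dropped.\<close>

lemma ex_basis:
  assumes "finite V" "sym_diff_closed V"
  shows "\<exists>B. is_basis B V"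
proof -
  define spans where "spans B \<longleftrightarrow> B \<subseteq> V \<and> V \<subseteq> symdiff_sum ` Pow B" for B
  have "spans V"
  proof -
    have "x \<in> symdiff_sum ` Pow V" if "x \<in> V" for x
      using that by (intro image_eqI[of _ _ "{x}"]) auto
    then show ?thesis by (auto simp: spans_def)
  qed
  then obtain B where B: "spans B" and minimal: "\<And>B'. spans B' \<Longrightarrow> card B \<le> card B'"
    using arg_min_nat_lemma[of spans V card] by blast
  have fin: "finite B" using B assms(1) finite_subset by (auto simp: spans_def)
  have finS: "finite S" if "S \<subseteq> B" for S using that fin finite_subset by blast
  have "inj_on symdiff_sum (Pow B)"
  proof (rule inj_onI, rule ccontr)
    fix S T assume ST: "S \<in> Pow B" "T \<in> Pow B" "symdiff_sum S = symdiff_sum T" "S \<noteq> T"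
    \<comment> \<open>Two representations of the same set differ by a nontrivial relation
      \<open>D\<close>, whose sum is empty.\<close>
    define D where "D = sym_diff S T"
    have D: "D \<subseteq> B" "symdiff_sum D = {}"
      using ST finS by (auto simp: D_def symdiff_sum_sym_diff)
    obtain A where A: "A \<in> D" using ST(4) by (auto simp: D_def)
    have "x \<in> symdiff_sum ` Pow (B - {A})" if "x \<in> V" for x
    proof -
      have "x \<in> symdiff_sum ` Pow B" using B that unfolding spans_def by (elim conjE) (rule subsetD)
      then obtain R where R: "x = symdiff_sum R" "R \<in> Pow B" by (rule imageE)
      \<comment> \<open>Adding the relation \<open>D\<close> keeps the sum and cancels
        \<open>A\<close> whenever \<open>A\<close> occurs in \<open>R\<close>.\<close>
      have "x = symdiff_sum (sym_diff R D)" using R D finS by (simp add: symdiff_sum_sym_diff)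
      moreover have "sym_diff R D \<subseteq> B - {A}" if "A \<in> R" using R D A that by auto
      moreover have "R \<subseteq> B - {A}" if "A \<notin> R" using R that by auto
      ultimately show ?thesis using R(1) by (cases "A \<in> R") (blast intro: image_eqI)+
    qed
    then have "spans (B - {A})" using B by (auto simp: spans_def)
    from minimal[OF this] show False
      using A D fin by (metis card_Diff1_less leD subsetD)
  qed
  moreover have "symdiff_sum ` Pow B \<subseteq> V"
  proof (rule image_subsetI)
    fix S assume "S \<in> Pow B"
    then show "symdiff_sum S \<in> V"
      using B finS by (intro symdiff_sum_mem[OF assms(2)]) (auto simp: spans_def)
  qed
  ultimately have "is_basis B V"
    using B by (simp add: is_basis_iff_bij_betw[OF fin assms(2)] bij_betw_def spans_def subset_antisym)
  then show ?thesis ..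
qed

section \<open>The cycle spaces \<open>H1 K\<close> and \<open>H2 K\<close>\<close>

lemma one_cycle_sym_diff:
  assumes "finite K" "one_cycle K C" "one_cycle K D"
  shows "one_cycle K (sym_diff C D)"
  unfolding one_cycle_def
proof (intro conjI ballI)
  show "sym_diff C D \<subseteq> K" using assms by (auto simp: one_cycle_def)
  fix v assume "v \<in> \<Union>K"
  moreover have "{e \<in> sym_diff C D. v \<in> e} = sym_diff {e \<in> C. v \<in> e} {e \<in> D. v \<in> e}" by auto
  moreover have "finite C" "finite D" using assms finite_subset by (auto simp: one_cycle_def)
  moreover have "even (card {e \<in> C. v \<in> e})" "even (card {e \<in> D. v \<in> e})"
    using assms calculation(1) unfolding one_cycle_def by blast+
  ultimately show "even (card {e \<in> sym_diff C D. v \<in> e})"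
    by (simp add: even_card_sym_diff)
qed

lemma one_cycle_empty: "one_cycle K {}"
  by (simp add: one_cycle_def)

lemma sym_diff_closed_H1:
  assumes "finite K"
  shows "sym_diff_closed (H1 K)"
  using assms one_cycle_sym_diff one_cycle_empty by (auto simp: sym_diff_closed_def H1_def)

lemma sym_diff_closed_H2:
  assumes "finite K"
  shows "sym_diff_closed (H2 K)"
proof -
  have "two_cycle K (sym_diff Z W)" if Z: "two_cycle K Z" and W: "two_cycle K W" for Z W
    unfolding two_cycle_def
  proof (intro conjI ballI)
    show "sym_diff Z W \<subseteq> K \<times> K" using Z W by (auto simp: two_cycle_def)
    fix s assume s: "s \<in> K"
    have "{t. (s, t) \<in> sym_diff Z W} = sym_diff {t. (s, t) \<in> Z} {t. (s, t) \<in> W}" by auto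
    then show "one_cycle K {t. (s, t) \<in> sym_diff Z W}"
      using one_cycle_sym_diff[OF assms] Z W s by (simp only: two_cycle_def)
    have "{t. (t, s) \<in> sym_diff Z W} = sym_diff {t. (t, s) \<in> Z} {t. (t, s) \<in> W}" by auto
    then show "one_cycle K {t. (t, s) \<in> sym_diff Z W}"
      using one_cycle_sym_diff[OF assms] Z W s by (simp only: two_cycle_def)
  qed
  moreover have "two_cycle K {}" by (simp add: two_cycle_def one_cycle_empty)
  ultimately show ?thesis by (auto simp: sym_diff_closed_def H2_def)
qed

lemma Times_mem_H2:
  assumes "X \<in> H1 K" "Y \<in> H1 K"
  shows "X \<times> Y \<in> H2 K"
proof -
  have "{t. (s, t) \<in> X \<times> Y} = (if s \<in> X then Y else {})"
    "{t. (t, s) \<in> X \<times> Y} = (if s \<in> Y then X else {})" for s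
    by auto
  moreover have "X \<times> Y \<subseteq> K \<times> K" using assms by (auto simp: H1_def one_cycle_def)
  ultimately show ?thesis
    using assms one_cycle_empty unfolding H1_def H2_def two_cycle_def mem_Collect_eq by metis
qed

section \<open>Products of basis cycles\<close>

lemma inj_on_Times:
  assumes "{} \<notin> B"
  shows "inj_on (\<lambda>(X, Y). X \<times> Y) (B \<times> B)"
  using assms by (auto simp: inj_on_def times_eq_iff)

text \<open>Grouping the products by second factor, \<open>Y\<close> enters the row over
  \<open>s\<close> once for each \<open>X\<close> paired with it that contains \<open>s\<close>;
  only the parity of this number survives.\<close>

lemma row_symdiff_sum_Times:
  assumes B: "finite B" "{} \<notin> B" and P: "P \<subseteq> B \<times> B"
  shows "{t. (s, t) \<in> symdiff_sum ((\<lambda>(X, Y). X \<times> Y) ` P)} =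
    symdiff_sum {Y \<in> B. s \<in> symdiff_sum {X. (X, Y) \<in> P}}"
proof (rule set_eqI, unfold mem_Collect_eq)
  fix t
  let ?f = "\<lambda>(X, Y). X \<times> Y :: ('a \<times> 'b) set"
  have finP: "finite P" using B P by (meson finite_SigmaI finite_subset)
  have fibre: "{X. (X, Y) \<in> P} = {X \<in> B. (X, Y) \<in> P}" for Y using P by auto
  have "{A \<in> ?f ` P. (s, t) \<in> A} = ?f ` {p \<in> P. s \<in> fst p \<and> t \<in> snd p}" by force
  moreover have "inj_on ?f {p \<in> P. s \<in> fst p \<and> t \<in> snd p}"
    using P by (intro inj_on_subset[OF inj_on_Times[OF B(2)]]) auto
  ultimately have "card {A \<in> ?f ` P. (s, t) \<in> A} = card {p \<in> P. s \<in> fst p \<and> t \<in> snd p}"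
    by (simp add: card_image)
  \<comment> \<open>Swapping the components sorts the pairs by their second factor.\<close>
  also have "\<dots> = card (SIGMA Y:B. {X \<in> B. (X, Y) \<in> P \<and> s \<in> X \<and> t \<in> Y})"
    using P by (intro bij_betw_same_card[of prod.swap] bij_betw_imageI) (force simp: image_iff)+
  also have "\<dots> = (\<Sum>Y\<in>B. card {X \<in> B. (X, Y) \<in> P \<and> s \<in> X \<and> t \<in> Y})"
    using B by simp
  finally have "(s, t) \<in> symdiff_sum (?f ` P) \<longleftrightarrow>
      odd (card {Y \<in> B. odd (card {X \<in> B. (X, Y) \<in> P \<and> s \<in> X \<and> t \<in> Y})})"
    using B finP by (simp add: mem_symdiff_sum even_sum_iff)
  also have "{Y \<in> B. odd (card {X \<in> B. (X, Y) \<in> P \<and> s \<in> X \<and> t \<in> Y})} =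
      {Y \<in> {Y \<in> B. s \<in> symdiff_sum {X. (X, Y) \<in> P}}. t \<in> Y}"
  proof -
    have "odd (card {X \<in> B. (X, Y) \<in> P \<and> s \<in> X \<and> t \<in> Y}) \<longleftrightarrow>
        s \<in> symdiff_sum {X. (X, Y) \<in> P} \<and> t \<in> Y" for Y
      using B odd_card_Collect_conj_const[of B "\<lambda>X. (X, Y) \<in> P \<and> s \<in> X" "t \<in> Y"]
      by (simp add: fibre mem_symdiff_sum conj_assoc)
    then show ?thesis by auto
  qed
  finally show "(s, t) \<in> symdiff_sum (?f ` P) \<longleftrightarrow>
      t \<in> symdiff_sum {Y \<in> B. s \<in> symdiff_sum {X. (X, Y) \<in> P}}"
    using B by (simp add: mem_symdiff_sum)
qed

lemma is_basis_Times:
  assumes K: "finite K" and finB: "finite B" and basis: "is_basis B (H1 K)"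
  shows "is_basis ((\<lambda>(X, Y). X \<times> Y) ` (B \<times> B)) (H2 K)"
proof -
  let ?f = "\<lambda>(X, Y). X \<times> Y :: ('a set \<times> 'a set) set"
  have BH: "B \<subseteq> H1 K" and bij: "bij_betw symdiff_sum (Pow B) (H1 K)"
    using basis is_basis_iff_bij_betw[OF finB sym_diff_closed_H1[OF K]] by auto
  have inj: "S = T" if "S \<subseteq> B" "T \<subseteq> B" "symdiff_sum S = symdiff_sum T" for S T
    using bij that by (auto simp: bij_betw_def inj_on_def)
  have ex: "\<exists>S. S \<subseteq> B \<and> symdiff_sum S = x" if "x \<in> H1 K" for x
  proof -
    have "x \<in> symdiff_sum ` Pow B" using bij that by (simp add: bij_betw_def)
    then show ?thesis by auto
  qed
  have finS: "finite S" if "S \<subseteq> B" for S using that finB finite_subset by blast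
  \<comment> \<open>Otherwise the coefficient sets \<open>{{}}\<close> and \<open>{}\<close> would
    both sum to \<open>{}\<close>.\<close>
  have nempty: "{} \<notin> B" using inj[of "{{}}" "{}"] by auto
  note row = row_symdiff_sum_Times[OF finB nempty]
  have inj2: "P = Q" if P: "P \<subseteq> B \<times> B" and Q: "Q \<subseteq> B \<times> B"
    and eq: "symdiff_sum (?f ` P) = symdiff_sum (?f ` Q)" for P Q
  proof -
    \<comment> \<open>First use of uniqueness: equal rows over \<open>s\<close> have equal
      coefficients.\<close>
    have *: "{Y \<in> B. s \<in> symdiff_sum {X. (X, Y) \<in> P}} = {Y \<in> B. s \<in> symdiff_sum {X. (X, Y) \<in> Q}}" for s
      using row[OF P, of s] row[OF Q, of s] eq by (intro inj) auto
    \<comment> \<open>Second use: read for fixed \<open>Y\<close> and varying \<open>s\<close>, the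
      previous fact says that the two fibres over \<open>Y\<close> have the same sum.\<close>
    have "{X. (X, Y) \<in> P} = {X. (X, Y) \<in> Q}" if "Y \<in> B" for Y
      using P Q * that by (intro inj) blast+
    then show ?thesis using P Q by blast
  qed
  have ex2: "\<exists>P. P \<subseteq> B \<times> B \<and> symdiff_sum (?f ` P) = Z" if "Z \<in> H2 K" for Z
  proof -
    have Z: "two_cycle K Z" and ZK: "Z \<subseteq> K \<times> K" using that by (auto simp: H2_def two_cycle_def)
    have "\<exists>S. S \<subseteq> B \<and> symdiff_sum S = {t. (s, t) \<in> Z}" if "s \<in> K" for s
      using Z that by (intro ex) (auto simp: two_cycle_def H1_def)
    then obtain S where S: "\<And>s. s \<in> K \<Longrightarrow> S s \<subseteq> B"
      and sumS: "\<And>s. s \<in> K \<Longrightarrow> symdiff_sum (S s) = {t. (s, t) \<in> Z}" by metis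
    define U where "U Y = {s \<in> K. Y \<in> S s}" for Y
    have "U Y \<in> H1 K" if Y: "Y \<in> B" for Y
    proof -
      have "even (card {s \<in> U Y. v \<in> s})" for v
      proof -
        \<comment> \<open>\<open>D\<close> is the set of edges at \<open>v\<close>, and
          \<open>W\<close> is the coefficient set of the sum of the rows over \<open>D\<close>. That
          sum is shown to vanish at every \<open>t\<close>.\<close>
        define D where "D = {s \<in> K. v \<in> s}"
        define W where "W = {Y \<in> B. odd (card {s \<in> D. Y \<in> S s})}"
        have "t \<notin> symdiff_sum W" for t
        proof -
          have "t \<in> symdiff_sum W \<longleftrightarrow>
              odd (card {Y \<in> B. odd (card {s \<in> D. Y \<in> S s \<and> t \<in> Y})})"
          proof -
            have "{A \<in> W. t \<in> A} = {Y \<in> B. odd (card {s \<in> D. Y \<in> S s \<and> t \<in> Y})}"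
              by (simp add: W_def odd_card_Collect_conj_const conj_assoc)
            then show ?thesis using finS[of W] by (simp add: mem_symdiff_sum W_def)
          qed
          also have "\<dots> \<longleftrightarrow> odd (card {s \<in> D. odd (card {Y \<in> B. Y \<in> S s \<and> t \<in> Y})})"
            using K finB by (intro odd_card_swap) (auto simp: D_def)
          also have "{s \<in> D. odd (card {Y \<in> B. Y \<in> S s \<and> t \<in> Y})} = {s \<in> D. (s, t) \<in> Z}"
          proof -
            have "odd (card {Y \<in> B. Y \<in> S s \<and> t \<in> Y}) \<longleftrightarrow> (s, t) \<in> Z" if "s \<in> D" for s
            proof -
              have s: "s \<in> K" using that by (simp add: D_def)
              have "{Y \<in> B. Y \<in> S s \<and> t \<in> Y} = {Y \<in> S s. t \<in> Y}" using S[OF s] by auto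
              then show ?thesis
                using mem_symdiff_sum[OF finS[OF S[OF s]], of t] sumS[OF s] by simp
            qed
            then show ?thesis by auto
          qed
          also have "{s \<in> D. (s, t) \<in> Z} = {s \<in> {s. (s, t) \<in> Z}. v \<in> s}"
            using ZK by (auto simp: D_def)
          also have "odd (card \<dots>) \<longleftrightarrow> False"
          \<comment> \<open>For an edge \<open>t\<close> and a vertex \<open>v\<close> of the graph,
            the column of \<open>Z\<close> at \<open>t\<close> is a cycle; in all other cases no
            edge is counted.\<close>
          proof (cases "t \<in> K \<and> v \<in> \<Union>K")
            case True
            then show ?thesis using Z by (auto simp: two_cycle_def one_cycle_def)
          next
            case False
            then have "{s \<in> {s. (s, t) \<in> Z}. v \<in> s} = {}" using ZK by auto
            then show ?thesis by (simp only: card.empty even_zero simp_thms)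
          qed
          finally show ?thesis by simp
        qed
        \<comment> \<open>\<open>W\<close> and \<open>{}\<close> have the same sum. Membership of
          \<open>Y\<close> in \<open>W\<close> is the parity of the degree of \<open>v\<close> in
          \<open>U Y\<close>, so this degree is even.\<close>
        then have "W = {}" by (intro inj) (auto simp: W_def)
        moreover have "{s \<in> U Y. v \<in> s} = {s \<in> D. Y \<in> S s}" by (auto simp: U_def D_def)
        ultimately show ?thesis using Y by (auto simp: W_def)
      qed
      then show ?thesis by (auto simp: H1_def one_cycle_def U_def)
    qed
    then have "\<forall>Y\<in>B. \<exists>S. S \<subseteq> B \<and> symdiff_sum S = U Y" by (intro ballI ex)
    then obtain T where T: "\<forall>Y\<in>B. T Y \<subseteq> B \<and> symdiff_sum (T Y) = U Y"
      by (rule bchoice[THEN exE])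
    \<comment> \<open>\<open>P\<close> collects the coefficients of all the \<open>U Y\<close>: its
      fibre over \<open>Y\<close> is \<open>T Y\<close>, with sum \<open>U Y\<close>.\<close>
    define P where "P = {(X, Y). Y \<in> B \<and> X \<in> T Y}"
    have P: "P \<subseteq> B \<times> B" using T by (auto simp: P_def)
    have "{t. (s, t) \<in> symdiff_sum (?f ` P)} = {t. (s, t) \<in> Z}" for s
    proof -
      have coeff: "{Y \<in> B. s \<in> symdiff_sum {X. (X, Y) \<in> P}} = {Y \<in> B. s \<in> U Y}"
        using T by (auto simp: P_def)
      show ?thesis
      proof (cases "s \<in> K")
        case True
        then have "{Y \<in> B. s \<in> U Y} = S s" using S by (auto simp: U_def)
        then show ?thesis using row[OF P, of s] coeff sumS[OF True] by simp
      next
        case False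
        then have "{Y \<in> B. s \<in> U Y} = {}" by (auto simp: U_def)
        then have "{t. (s, t) \<in> symdiff_sum (?f ` P)} = {}"
          by (simp only: row[OF P] coeff symdiff_sum_empty)
        moreover have "{t. (s, t) \<in> Z} = {}" using ZK False by auto
        ultimately show ?thesis by (simp only:)
      qed
    qed
    then have "(s, t) \<in> symdiff_sum (?f ` P) \<longleftrightarrow> (s, t) \<in> Z" for s t
      by (simp only: set_eq_iff mem_Collect_eq)
    then have "symdiff_sum (?f ` P) = Z" by (simp only: set_eq_iff split_paired_All simp_thms)
    with P show ?thesis by (intro exI[of _ P] conjI)
  qed
  have sub: "?f ` (B \<times> B) \<subseteq> H2 K"
  proof (rule image_subsetI)
    fix p assume "p \<in> B \<times> B"
    then obtain X Y where "p = (X, Y)" "X \<in> H1 K" "Y \<in> H1 K" using BH by auto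
    then show "?f p \<in> H2 K" by (simp add: Times_mem_H2)
  qed
  have "bij_betw symdiff_sum (Pow (?f ` (B \<times> B))) (H2 K)"
    unfolding bij_betw_def
  proof
    show "inj_on symdiff_sum (Pow (?f ` (B \<times> B)))"
    proof (rule inj_onI)
      fix M N assume M: "M \<in> Pow (?f ` (B \<times> B))" and N: "N \<in> Pow (?f ` (B \<times> B))"
        and eq: "symdiff_sum M = symdiff_sum N"
      \<comment> \<open>A family of products is pulled back to a set of index pairs, where
        \<open>inj2\<close> applies.\<close>
      from M obtain P where P: "P \<subseteq> B \<times> B" "M = ?f ` P" by (auto elim: subset_imageE)
      from N obtain Q where Q: "Q \<subseteq> B \<times> B" "N = ?f ` Q" by (auto elim: subset_imageE)
      show "M = N" using inj2[OF P(1) Q(1)] eq P(2) Q(2) by simp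
    qed
    show "symdiff_sum ` Pow (?f ` (B \<times> B)) = H2 K"
    proof
      show "symdiff_sum ` Pow (?f ` (B \<times> B)) \<subseteq> H2 K"
      proof (rule image_subsetI)
        fix M assume M: "M \<in> Pow (?f ` (B \<times> B))"
        then have "finite M" using finB by (meson PowD finite_SigmaI finite_imageI finite_subset)
        moreover have "M \<subseteq> H2 K" using M sub by (meson PowD subset_trans)
        ultimately show "symdiff_sum M \<in> H2 K"
          by (rule symdiff_sum_mem[OF sym_diff_closed_H2[OF K]])
      qed
      show "H2 K \<subseteq> symdiff_sum ` Pow (?f ` (B \<times> B))"
      proof
        fix Z assume "Z \<in> H2 K"
        then obtain P where P: "P \<subseteq> B \<times> B" "symdiff_sum (?f ` P) = Z" using ex2 by blast
        then show "Z \<in> symdiff_sum ` Pow (?f ` (B \<times> B))"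
          by (intro image_eqI[of _ _ "?f ` P"]) auto
      qed
    qed
  qed
  moreover have "finite (?f ` (B \<times> B))" using finB by simp
  ultimately show ?thesis using sub is_basis_iff_bij_betw[OF _ sym_diff_closed_H2[OF K]] by simp
qed

theorem mainTheorem4:
  fixes K :: "'a set set"
  assumes "graph K"
  shows "(\<exists>(q::nat) (C :: nat \<Rightarrow> 'a set set).
            inj_on C {1..q} \<and> is_basis (C ` {1..q}) (H1 K) \<and>
            is_basis (product_cycles q C) (H2 K)) \<and>
         (\<forall>(q::nat) (C :: nat \<Rightarrow> 'a set set).
            is_basis (C ` {1..q}) (H1 K) \<longrightarrow> is_basis (product_cycles q C) (H2 K))"
proof -
  have K: "finite K" using assms by (simp add: graph_def)
  have prod: "is_basis (product_cycles q C) (H2 K)" if "is_basis (C ` {1..q}) (H1 K)" for q C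
  proof -
    \<comment> \<open>Both sides depend only on the set of values of \<open>C\<close>, so repeated
      values collapse.\<close>
    have "product_cycles q C = (\<lambda>(X, Y). X \<times> Y) ` (C ` {1..q} \<times> C ` {1..q})"
      unfolding product_cycles_def by force
    then show ?thesis using is_basis_Times[OF K _ that] by simp
  qed
  have "H1 K \<subseteq> Pow K" by (auto simp: H1_def one_cycle_def)
  then have fin: "finite (H1 K)" using K finite_subset by blast
  then obtain B where B: "is_basis B (H1 K)" using ex_basis sym_diff_closed_H1[OF K] by blast
  then have "finite B" using fin finite_subset by (auto simp: is_basis_def)
  \<comment> \<open>The witness for the first claim is any enumeration of \<open>B\<close> starting
    at 1, with \<open>q = card B\<close>, possibly 0.\<close>
  then obtain C where "bij_betw C {1..card B} B" using ex_bij_betw_nat_finite_1 by blast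
  then have "inj_on C {1..card B}" "C ` {1..card B} = B" by (auto simp: bij_betw_def)
  then show ?thesis using prod B by metis
qed

end
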